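(* Consider the opinion dynamics $\dot x=A(x)Ex$ with $E=B-\Sigma$ and $A(x)=\mathrm{diag}(x)^2$ (stubborn neutrals scenario), with states $x(t)\in[-1,1]^N$ for all $t\ge 0$, where $B\in\mathbb{R}^{N\times N}$ is the adjacency matrix of a strongly connected signed digraph with $b_{ii}=0$ and $\Sigma=\mathrm{diag}\{\sigma_1,\dots,\sigma_N\}$ with all $\sigma_i>0$. Suppose that Assumption 1 holds or Assumption 2 holds (both stated in the context), and that there exists a positive diagonal matrix $\Gamma=\mathrm{diag}\{\gamma_1,\dots,\gamma_N\}$ such that $H(\Gamma E)\preceq 0$ and $\mathrm{rank}\,H(\Gamma E)=\mathrm{rank}\,E$. Let $v_r$ be the right positive eigenvector of $B$ (under Assumption 1), respectively of $C$ (under Assumption 2). If $\sigma_i=\sigma_j=\rho(B)$ for all $i,j=1,\dots,N$ (under Assumption 1), respectively $d=\rho(C)$ (under Assumption 2), then: 1) when $x(0)>\mathbf 0$, $\lim_{t\to\infty}x(t)=\alpha v_r$ for some $\alpha\in\big(0,\frac{1}{\|v_r\|_\infty}\big]$; 2) when $x(0)<\mathbf 0$, $\lim_{t\to\infty}x(t)=\alpha v_r$ for some $\alpha\in\big[-\frac{1}{\|v_r\|_\infty},0\big)$; 3) otherwise, $\lim_{t\to\infty}x(t)=\mathbf 0$. If $\sigma_i=\sigma_j>\rho(B)$ for all $i,j=1,\dots,N$ (under Assumption 1), respectively $d>\rho(C)$ (under Assumption 2), then $\lim_{t\to\infty}x(t)=\mathbf 0$ for all $x(0)\in[-1,1]^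N$.
   Context: Notation. $\mathbf 0$ is the zero vector; vector inequalities are entrywise and strict ($x>\mathbf 0$ means $x_i>0$ for all $i$). $\mathrm{diag}(x)^2=\mathrm{diag}\{x_1^2,\dots,x_N^2\}$. $\|x\|_\infty=\max_i|x_i|$. $\rho(\cdot)$ is the spectral radius. $H(M)=\frac12(M+M^{\mathrm T})$; $\preceq 0$ means negative semidefinite. A real square matrix $M$ is eventually positive if there is a positive integer $k_0$ such that $M^k$ has all entries strictly positive for every $k\ge k_0$. Model. Agent states satisfy $x_i(t)\in[-1,1]$ (standing assumption: solutions are considered with values in $[-1,1]^N$ for all $t\ge0$). $B=[b_{ij}]$ is a real matrix (entries of either sign) with $b_{ii}=0$ that is the adjacency matrix of a strongly connected signed digraph, i.e. $B$ is irreducible. $\sigma_i>0$ for all $i$. $E=B-\Sigma$. Assumption 1. $B$ is eventually positive, and $\sigma_i=\sigma_j\ge\rho(B)$ for all $i,j=1,\dots,N$. Assumption 2. $B$ is not eventually positive, and $E$ can be written as $E=C-dI$, where $C=B+D$ is eventually positive, $D=dI-\Sigma$, and $d\ge\rho(C)$. The spectral radius of an eventually positive matrix is a simple positive eigenvalue with an entrywise positive right eigenvector (unique up to positive scaling); $v_r$ denotes this eigenvector of $B$ (Assumption 1) or of $C$ (Assumption 2). *)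

theory Defs
  imports
    "HOL-Analysis.Analysis"
    "HOL-Computational_Algebra.Fundamental_Theorem_Algebra"
    "Graph_Theory.Digraph_Component"
begin

definition diag_mat :: "real^'n \<Rightarrow> real^'n^'n" where
  "diag_mat v = (\<chi> i j. if i = j then v $ i else 0)"

(* On vec types the operator ^ would be built from the entrywise product,
   so powers for the matrix product are introduced separately. *)
definition mat_pow :: "real^'n^'n \<Rightarrow> nat \<Rightarrow> real^'n^'n" where
  "mat_pow M k = (((**) M) ^^ k) (mat 1)"

definition eventually_positive :: "real^'n^'n \<Rightarrow> bool" where
  "eventually_positive M \<longleftrightarrow> (\<exists>k0>0. \<forall>k\<ge>k0. \<forall>i j. mat_pow M k $ i $ j > 0)"

definition complex_spectrum :: "real^'n^'n \<Rightarrow> complex set" where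
  "complex_spectrum M =
     {z. \<exists>v::complex^'n. v \<noteq> 0 \<and> (\<chi> i j. complex_of_real (M $ i $ j)) *v v = z *s v}"

definition spectral_radius :: "real^'n^'n \<Rightarrow> real" where
  "spectral_radius M = Max (cmod ` complex_spectrum M)"

definition sym_part :: "real^'n^'n \<Rightarrow> real^'n^'n" where
  "sym_part M = (1/2) *\<^sub>R (M + transpose M)"

definition neg_semidefinite :: "real^'n^'n \<Rightarrow> bool" where
  "neg_semidefinite M \<longleftrightarrow> transpose M = M \<and> (\<forall>x. x \<bullet> (M *v x) \<le> 0)"

(* The entry b_ij weights the influence of agent j on agent i, so it is read as an arc (j, i). *)
definition signed_digraph :: "real^'n^'n \<Rightarrow> 'n pair_pre_digraph" where
  "signed_digraph B = \<lparr> pverts = UNIV, parcs = {(j, i). B $ i $ j \<noteq> 0} \<rparr>"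

definition E_mat :: "real^'n^'n \<Rightarrow> real^'n \<Rightarrow> real^'n^'n" where
  "E_mat B \<sigma> = B - diag_mat \<sigma>"

definition C_mat :: "real^'n^'n \<Rightarrow> real^'n \<Rightarrow> real \<Rightarrow> real^'n^'n" where
  "C_mat B \<sigma> d = B + (mat d - diag_mat \<sigma>)"

definition assumption1 :: "real^'n^'n \<Rightarrow> real^'n \<Rightarrow> bool" where
  "assumption1 B \<sigma> \<longleftrightarrow>
     eventually_positive B \<and> (\<forall>i j. \<sigma> $ i = \<sigma> $ j \<and> \<sigma> $ j \<ge> spectral_radius B)"

definition assumption2 :: "real^'n^'n \<Rightarrow> real^'n \<Rightarrow> real \<Rightarrow> bool" where
  "assumption2 B \<sigma> d \<longleftrightarrow>
     \<not> eventually_positive B \<and>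
     E_mat B \<sigma> = C_mat B \<sigma> d - mat d \<and>
     eventually_positive (C_mat B \<sigma> d) \<and>
     d \<ge> spectral_radius (C_mat B \<sigma> d)"

definition positive_right_eigenvector :: "real^'n^'n \<Rightarrow> real^'n \<Rightarrow> bool" where
  "positive_right_eigenvector M v \<longleftrightarrow>
     M *v v = spectral_radius M *\<^sub>R v \<and> (\<forall>i. v $ i > 0)"

definition stubborn_neutrals_solution ::
    "real^'n^'n \<Rightarrow> (real \<Rightarrow> real^'n) \<Rightarrow> bool" where
  "stubborn_neutrals_solution E x \<longleftrightarrow>
     (\<forall>t\<ge>0. (x has_vector_derivative
        ((diag_mat (x t) ** diag_mat (x t)) *v (E *v x t))) (at t within {0..})) \<and>
     (\<forall>t\<ge>0. \<forall>i. x t $ i \<in> {-1..1})"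

(* Vector inequalities are strict in every entry; the order on vec types
   is not used because its < is only strict in some entry. *)
definition limit_trichotomy :: "(real \<Rightarrow> real^'n) \<Rightarrow> real^'n \<Rightarrow> bool" where
  "limit_trichotomy x v \<longleftrightarrow>
     ((\<forall>i. x 0 $ i > 0) \<longrightarrow>
        (\<exists>\<alpha>\<in>{0<..1 / infnorm v}. (x \<longlongrightarrow> \<alpha> *\<^sub>R v) at_top)) \<and>
     ((\<forall>i. x 0 $ i < 0) \<longrightarrow>
        (\<exists>\<alpha>\<in>{- (1 / infnorm v)..<0}. (x \<longlongrightarrow> \<alpha> *\<^sub>R v) at_top)) \<and>
     (\<not> (\<forall>i. x 0 $ i > 0) \<and> \<not> (\<forall>i. x 0 $ i < 0) \<longrightarrow> (x \<longlongrightarrow> 0) at_top)"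

lemma E_mat_eq_C_mat: "E_mat B \<sigma> = C_mat B \<sigma> d - mat d"
  by (simp add: E_mat_def C_mat_def)

lemma infnorm_vec: "infnorm (v :: real^'n) = Max (range (\<lambda>i. \<bar>v $ i\<bar>))"
  unfolding infnorm_cart
  by (subst cSup_eq_Max) (auto simp: full_SetCompr_eq)

lemma complex_spectrum_finite_nonempty:
  fixes M :: "real^'n^'n"
  shows "finite (complex_spectrum M) \<and> complex_spectrum M \<noteq> {}"
proof -
  define A :: "complex^'n^'n" where "A = (\<chi> i j. complex_of_real (M $ i $ j))"
  define p :: "complex poly" where
    "p = det (\<chi> i j. (if i = j then [:0, 1:] else 0) - [:A $ i $ j:])"
  have p: "poly p z = det (mat z - A)" for z
    unfolding p_def det_def by (auto simp: poly_sum poly_prod mat_def intro!: sum.cong prod.cong)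
  have spec: "z \<in> complex_spectrum M \<longleftrightarrow> poly p z = 0" for z
  proof -
    have "z \<in> complex_spectrum M \<longleftrightarrow> (\<exists>v. v \<noteq> 0 \<and> (mat z - A) *v v = 0)"
    proof -
      have "mat z *v v = z *s v" for v :: "complex^'n"
        by (simp add: vec_eq_iff matrix_vector_mult_def mat_def if_distrib if_distribR cong: if_cong)
      then show ?thesis
        by (auto simp: complex_spectrum_def A_def matrix_vector_mult_diff_rdistrib)
    qed
    also have "\<dots> \<longleftrightarrow> \<not> invertible (mat z - A)"
      using matrix_left_invertible_ker[of "mat z - A"] invertible_left_inverse by blast
    finally show ?thesis by (simp add: invertible_det_nz p)
  qed
  have nonconst: "\<not> constant (poly p)"
  proof
    assume "constant (poly p)"
    then have c: "poly p z = poly p 0" for z by (auto simp: constant_def)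
    define q where "q = (\<lambda>u. det (mat 1 - (\<chi> i j. u * A $ i $ j)))"
    have q: "q u = u ^ CARD('n) * poly p 0" if "u \<noteq> 0" for u
    proof -
      have "(mat 1 - (\<chi> i j. u * A $ i $ j)) = (\<chi> i. u *s ((mat (1/u) - A) $ i))"
        using that by (auto simp: vec_eq_iff mat_def field_simps)
      then have "q u = prod (\<lambda>i. u) (UNIV::'n set) * det (\<chi> i. (mat (1/u) - A) $ i)"
        unfolding q_def by (simp only: det_rows_mul)
      moreover have "(\<chi> i. (mat (1/u) - A) $ i) = mat (1/u) - A" by (simp add: vec_eq_iff)
      ultimately show ?thesis using p[of "1/u"] c[of "1/u"] by simp
    qed
    have "isCont q 0" unfolding q_def det_def by (auto simp: mat_def intro!: continuous_intros)
    then have "(q \<longlongrightarrow> q 0) (at 0)" by (simp add: isCont_def)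
    moreover have "(q \<longlongrightarrow> 0 ^ CARD('n) * poly p 0) (at 0)"
      by (rule Lim_transform_eventually[of "\<lambda>u. u ^ CARD('n) * poly p 0"])
         (auto simp: q eventually_at_filter intro!: tendsto_intros)
    moreover have "q 0 = 1"
    proof -
      have "(\<chi> i j. 0 * A $ i $ j) = 0" by (simp add: vec_eq_iff)
      then show ?thesis unfolding q_def by simp
    qed
    ultimately have "(1::complex) = 0 ^ CARD('n) * poly p 0"
      using tendsto_unique trivial_limit_at by metis
    then show False by (simp add: power_0_left)
  qed
  have "p \<noteq> 0" using nonconst by (auto simp: constant_def)
  moreover have "complex_spectrum M = {z. poly p z = 0}"
    using spec by blast
  ultimately have "finite (complex_spectrum M)"
    by (simp add: poly_roots_finite)
  moreover have "complex_spectrum M \<noteq> {}"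
    using fundamental_theorem_of_algebra[OF nonconst] spec by blast
  ultimately show ?thesis ..
qed

end

theory Submission
  imports Defs
begin

text \<open>
  Write $E = C - dI$ with $C$ eventually positive. The hypothesis on $\Gamma$ makes the form
  $Q(y) = y^T \Gamma E y$ nonpositive, with zeros exactly on $\ker E$, which is spanned by $v_r$ if
  $d = \rho(C)$ and trivial if $d > \rho(C)$. Along a trajectory, coordinates keep their sign and
  $\sum_i \gamma_i \ln |x_i|$ has derivative $Q(x)$.

  If $x(0) > 0$ and $d = \rho(C)$, then $\Gamma v_r$ is a left null vector of $E$, so
  $\sum_i \gamma_i v_i / x_i$ is conserved. This keeps the trajectory away from the boundary of the
  orthant, so every cluster point lies on the ray of $v_r$, and it fixes the position on that ray.

  In all other cases a nonzero cluster point $p$ is excluded. Following the trajectory backwards from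
  times at which it is close to $p$, the logarithmic functional over the support of $p$ would grow
  beyond its upper bound $0$, unless $\ker E$ contains a vector with exactly the sign pattern of $p$.
\<close>

section \<open>Kernels of eventually positive and of dissipative matrices\<close>

lemma mat_vec_mult: "mat d *v y = d *\<^sub>R (y :: real^'n)"
  by (simp add: vec_eq_iff matrix_vector_mult_def mat_def if_distrib if_distribR cong: if_cong)

lemma diag_mat_vec_mult: "(diag_mat a *v y) $ i = a $ i * y $ i"
  by (simp add: matrix_vector_mult_def diag_mat_def if_distrib if_distribR cong: if_cong)

lemma mat_pow_eigenvector:
  assumes "M *v u = r *\<^sub>R u"
  shows "mat_pow M k *v u = r ^ k *\<^sub>R u"
proof (induction k)
  case 0
  then show ?case by (simp add: mat_pow_def)
next
  case (Suc k)
  have "mat_pow M (Suc k) = M ** mat_pow M k"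
    by (simp add: mat_pow_def)
  then show ?case
    using Suc assms by (simp add: matrix_vector_mul_assoc[symmetric] matrix_vector_mult_scaleR)
qed

text \<open>Perron-type argument: subtract from \<open>u\<close> the largest multiple of
  \<open>v\<close> that leaves a nonnegative vector \<open>w\<close>. Some entry of \<open>w\<close>
  is zero, and a power of \<open>M\<close> with all entries positive would make that entry positive
  unless \<open>w = 0\<close>.\<close>

lemma eventually_positive_eigenspace:
  fixes M :: "real^'n^'n"
  assumes "eventually_positive M"
    and v: "M *v v = r *\<^sub>R v" "\<And>i. v $ i > 0"
    and u: "M *v u = r *\<^sub>R u"
  shows "\<exists>a. u = a *\<^sub>R v"
proof -
  define a where "a = Min (range (\<lambda>i. u $ i / v $ i))"
  have "a \<in> range (\<lambda>i. u $ i / v $ i)"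
    unfolding a_def by (rule Min_in) auto
  then obtain j where j: "a = u $ j / v $ j" by auto
  define w where "w = u - a *\<^sub>R v"
  have w: "M *v w = r *\<^sub>R w"
    using v(1) u by (simp add: w_def matrix_vector_mult_diff_distrib matrix_vector_mult_scaleR
        scaleR_right_diff_distrib)
  have w_nonneg: "w $ i \<ge> 0" for i
  proof -
    have "a \<le> u $ i / v $ i"
      unfolding a_def by (rule Min_le) auto
    then show ?thesis
      using v(2)[of i] by (simp add: w_def field_simps)
  qed
  have wj: "w $ j = 0"
    using v(2)[of j] by (simp add: w_def j)
  obtain k where k: "\<And>i j. mat_pow M k $ i $ j > 0"
    using assms(1) unfolding eventually_positive_def by blast
  have "(\<Sum>i\<in>UNIV. mat_pow M k $ j $ i * w $ i) = 0"
    using arg_cong[OF mat_pow_eigenvector[OF w, of k], of "\<lambda>y. y $ j"] wj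
    by (simp add: matrix_vector_mult_def)
  then have "\<forall>i\<in>UNIV. mat_pow M k $ j $ i * w $ i = 0"
    by (subst (asm) sum_nonneg_eq_0_iff) (auto intro!: mult_nonneg_nonneg w_nonneg less_imp_le[OF k])
  then have "w $ i = 0" for i
    using k[of j i] by (metis UNIV_I less_irrefl mult_eq_0_iff)
  then have "w = 0" by (simp add: vec_eq_iff)
  then show ?thesis by (auto simp: w_def)
qed

text \<open>A real eigenvector, read as a complex one, puts \<open>r\<close> into the complex
  spectrum. This makes the kernel of \<open>C - d I\<close> trivial when \<open>d\<close> exceeds
  the spectral radius of \<open>C\<close>.\<close>

lemma real_eigenvalue_le_spectral_radius:
  fixes M :: "real^'n^'n"
  assumes "M *v u = r *\<^sub>R u" "u \<noteq> 0"
  shows "\<bar>r\<bar> \<le> spectral_radius M"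
proof -
  define z :: "complex^'n" where "z = (\<chi> i. complex_of_real (u $ i))"
  have "z \<noteq> 0"
    using assms(2) by (auto simp: z_def vec_eq_iff)
  moreover have "(\<chi> i j. complex_of_real (M $ i $ j)) *v z = complex_of_real r *s z"
  proof -
    have "(\<Sum>j\<in>UNIV. complex_of_real (M $ i $ j) * complex_of_real (u $ j)) =
        complex_of_real r * complex_of_real (u $ i)" for i
    proof -
      have "(\<Sum>j\<in>UNIV. M $ i $ j * u $ j) = r * u $ i"
        using arg_cong[OF assms(1), of "\<lambda>y. y $ i"] by (simp add: matrix_vector_mult_def)
      then show ?thesis
        by (metis (mono_tags, lifting) of_real_mult of_real_sum sum.cong)
    qed
    then show ?thesis
      by (simp add: vec_eq_iff matrix_vector_mult_def z_def)
  qed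
  ultimately have "complex_of_real r \<in> complex_spectrum M"
    unfolding complex_spectrum_def by blast
  then have "cmod (complex_of_real r) \<le> spectral_radius M"
    unfolding spectral_radius_def using complex_spectrum_finite_nonempty[of M]
    by (intro Max_ge finite_imageI imageI) auto
  then show ?thesis by simp
qed

text \<open>The kernel is the orthogonal complement of the row space.\<close>

lemma dim_kernel_plus_rank:
  fixes A :: "real^'n^'m"
  shows "dim {y. A *v y = 0} + rank A = CARD('n)"
proof -
  have "dim {y \<in> UNIV. \<forall>r \<in> span (rows A). orthogonal r y} + dim (span (rows A)) =
      dim (UNIV :: (real^'n) set)"
    by (rule dim_subspace_orthogonal_to_vectors) auto
  moreover have "(\<forall>r \<in> span (rows A). orthogonal r y) \<longleftrightarrow> A *v y = 0" for y
  proof -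
    have "(\<forall>r \<in> span (rows A). orthogonal r y) \<longleftrightarrow> (\<forall>r \<in> rows A. orthogonal r y)"
      using orthogonal_to_span[of _ "rows A" y] by (auto intro: span_base simp: orthogonal_commute)
    also have "\<dots> \<longleftrightarrow> A *v y = 0"
      by (auto simp: rows_def orthogonal_def vec_eq_iff[of "A *v y"] matrix_vector_mul_component
          row_def)
    finally show ?thesis .
  qed
  ultimately show ?thesis
    by (simp add: row_rank_def)
qed

text \<open>If \<open>z = H *v y\<close> were nonzero, moving from \<open>y\<close> a little in the
  direction \<open>z\<close> would make the form positive: the first-order term is
  \<open>2 * s * (z \<bullet> z)\<close>, the second-order term is negligible.\<close>

lemma neg_semidefinite_isotropic:
  fixes H :: "real^'n^'n"
  assumes "neg_semidefinite H" "y \<bullet> (H *v y) = 0"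
  shows "H *v y = 0"
proof (rule ccontr)
  assume nz: "H *v y \<noteq> 0"
  define z where "z = H *v y"
  define q where "q = z \<bullet> (H *v z)"
  have sym: "transpose H = H" and neg: "\<And>x. x \<bullet> (H *v x) \<le> 0"
    using assms(1) by (auto simp: neg_semidefinite_def)
  have pos: "z \<bullet> z > 0" using nz by (simp add: z_def)
  have yz: "y \<bullet> (H *v z) = z \<bullet> z"
    by (metis dot_lmul_matrix sym transpose_matrix_vector z_def)
  have *: "2 * s * (z \<bullet> z) + s\<^sup>2 * q \<le> 0" for s
  proof -
    have "(y + s *\<^sub>R z) \<bullet> (H *v (y + s *\<^sub>R z)) = 2 * s * (z \<bullet> z) + s\<^sup>2 * q"
      using assms(2) yz
      by (simp add: matrix_vector_right_distrib matrix_vector_mult_scaleR inner_add_left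
          inner_add_right distrib_left q_def z_def[symmetric] power2_eq_square)
    then show ?thesis using neg[of "y + s *\<^sub>R z"] by simp
  qed
  \<comment> \<open>Small enough that \<open>s * q\<close> is at most \<open>z \<bullet> z\<close>
    in absolute value; the added 1 covers \<open>q = 0\<close>.\<close>
  define s where "s = (z \<bullet> z) / (\<bar>q\<bar> + 1)"
  have s: "s > 0" using pos by (simp add: s_def)
  have "\<bar>s * q\<bar> \<le> z \<bullet> z"
  proof -
    have "s * \<bar>q\<bar> \<le> s * (\<bar>q\<bar> + 1)" using s by (intro mult_left_mono) auto
    also have "\<dots> = z \<bullet> z" by (simp add: s_def)
    finally show ?thesis using s by (simp add: abs_mult)
  qed
  then have "2 * (z \<bullet> z) + s * q > 0" using pos by linarith
  then have "s * (2 * (z \<bullet> z) + s * q) > 0" using s by simp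
  then show False using *[of s] by (simp add: algebra_simps power2_eq_square)
qed

text \<open>The antisymmetric part of a matrix contributes nothing to its quadratic form.\<close>

lemma sym_part_quadratic_form:
  fixes E :: "real^'n^'n"
  shows "y \<bullet> (sym_part (diag_mat \<gamma> ** E) *v y) = (\<Sum>i\<in>UNIV. \<gamma> $ i * y $ i * (E *v y) $ i)"
proof -
  define P where "P = diag_mat \<gamma> ** E"
  have "y \<bullet> (transpose P *v y) = y \<bullet> (P *v y)"
    by (metis dot_lmul_matrix inner_commute transpose_matrix_vector)
  then have "y \<bullet> (sym_part P *v y) = y \<bullet> (P *v y)"
    by (simp add: sym_part_def matrix_vector_mult_add_rdistrib scaleR_matrix_vector_assoc[symmetric]
        inner_add_right)
  also have "\<dots> = (\<Sum>i\<in>UNIV. \<gamma> $ i * y $ i * (E *v y) $ i)"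
    by (simp add: P_def inner_vec_def matrix_vector_mul_assoc[symmetric] diag_mat_vec_mult mult_ac)
  finally show ?thesis by (simp add: P_def)
qed

text \<open>A null vector of \<open>E\<close> is isotropic for the semidefinite symmetric part,
  hence in its kernel. Equal ranks give equal dimensions, so this inclusion of kernels is an
  equality.\<close>

lemma sym_part_kernel:
  fixes E :: "real^'n^'n"
  assumes neg: "neg_semidefinite (sym_part (diag_mat \<gamma> ** E))" 
    and rank: "rank (sym_part (diag_mat \<gamma> ** E)) = rank E"
  shows "sym_part (diag_mat \<gamma> ** E) *v y = 0 \<longleftrightarrow> E *v y = 0"
proof -
  let ?H = "sym_part (diag_mat \<gamma> ** E)"
  have sub: "{y. E *v y = 0} \<subseteq> {y. ?H *v y = 0}"
  proof safe
    fix y assume "E *v y = 0"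
    then have "y \<bullet> (?H *v y) = 0" by (simp add: sym_part_quadratic_form)
    then show "?H *v y = 0" by (rule neg_semidefinite_isotropic[OF neg])
  qed
  have subsp: "subspace {y. A *v y = 0}" for A :: "real^'n^'n"
    by (simp add: subspace_def matrix_vector_right_distrib matrix_vector_mult_scaleR)
  have "dim {y. E *v y = 0} = dim {y. ?H *v y = 0}"
    using dim_kernel_plus_rank[of E] dim_kernel_plus_rank[of ?H] rank by simp
  then have "{y. E *v y = 0} = {y. ?H *v y = 0}"
    by (intro subspace_dim_equal subsp sub) auto
  then show ?thesis by blast
qed

text \<open>\<open>v\<close> is killed by \<open>P\<close> and, being isotropic, by its symmetric
  part; so it is killed by \<open>transpose P\<close> as well.\<close>

lemma left_null_vector:
  fixes E :: "real^'n^'n"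
  assumes neg: "neg_semidefinite (sym_part (diag_mat \<gamma> ** E))"
    and v: "E *v v = 0"
  shows "(\<Sum>i\<in>UNIV. \<gamma> $ i * v $ i * (E *v y) $ i) = 0"
proof -
  define P where "P = diag_mat \<gamma> ** E"
  have "v \<bullet> (sym_part P *v v) = 0"
    using v by (simp add: sym_part_quadratic_form P_def)
  then have "sym_part P *v v = 0"
    using neg_semidefinite_isotropic[OF neg] by (simp only: P_def)
  moreover have "P *v v = 0"
    using v by (simp add: P_def matrix_vector_mul_assoc[symmetric])
  ultimately have "transpose P *v v = 0"
    by (simp add: sym_part_def matrix_vector_mult_add_rdistrib scaleR_matrix_vector_assoc[symmetric])
  then have "v \<bullet> (P *v y) = 0"
    by (metis dot_lmul_matrix inner_zero_left transpose_matrix_vector)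
  then show ?thesis
    by (simp add: P_def inner_vec_def matrix_vector_mul_assoc[symmetric] diag_mat_vec_mult mult_ac)
qed

section \<open>Real analysis\<close>

text \<open>Mean value theorem, phrased with the one-sided derivative at time 0 that the solutions
  have. The case \<open>c = 0\<close> gives monotonicity.\<close>

lemma derivative_bound_imp_increment_bound:
  fixes f :: "real \<Rightarrow> real"
  assumes "a \<le> b" "0 \<le> a"
    and "\<And>t. t \<ge> 0 \<Longrightarrow> (f has_real_derivative f' t) (at t within {0..})"
    and "\<And>t. a \<le> t \<Longrightarrow> t \<le> b \<Longrightarrow> f' t \<le> c"
  shows "f b \<le> f a + c * (b - a)"
proof -
  have "\<exists>t\<in>{a..b}. f b - f a = (\<lambda>h. f' t * h) (b - a)"
  proof (rule mvt_very_simple[OF assms(1)])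
    fix t assume "a \<le> t" "t \<le> b"
    then have "(f has_real_derivative f' t) (at t within {a..b})"
      using DERIV_subset[OF assms(3)] assms(2) by auto
    then show "(f has_derivative (*) (f' t)) (at t within {a..b})"
      by (simp add: has_field_derivative_def)
  qed
  then obtain t where "t \<in> {a..b}" "f b - f a = f' t * (b - a)" by auto
  moreover have "f' t * (b - a) \<le> c * (b - a)"
    using assms(1,4) \<open>t \<in> {a..b}\<close> by (intro mult_right_mono) auto
  ultimately show ?thesis by linarith
qed

text \<open>The continuous function \<open>max (G y) (- F y)\<close> is positive on
  \<open>S\<close>; its minimum over the compact set serves as \<delta>.\<close>

lemma compact_uniformly_negative:
  fixes F G :: "'a::metric_space \<Rightarrow> real"
  assumes "compact S" "continuous_on S F" "continuous_on S G"
    and "\<And>y. y \<in> S \<Longrightarrow> G y \<le> 0 \<Longrightarrow> F y < 0"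
  shows "\<exists>\<delta>>0. \<forall>y\<in>S. G y < \<delta> \<longrightarrow> F y \<le> - \<delta>"
proof (cases "S = {}")
  case False
  define h where "h = (\<lambda>y. max (G y) (- F y))"
  have "continuous_on S h"
    unfolding h_def using assms by (intro continuous_intros)
  then obtain y0 where y0: "y0 \<in> S" "\<forall>y\<in>S. h y0 \<le> h y"
    using continuous_attains_inf[OF assms(1) False] by blast
  have "h y0 > 0"
    using assms(4)[OF y0(1)] unfolding h_def by (cases "G y0 \<le> 0") auto
  moreover have "F y \<le> - h y0" if "y \<in> S" "G y < h y0" for y
  proof -
    have "h y0 \<le> max (G y) (- F y)" using y0(2) that(1) by (simp add: h_def)
    then show ?thesis using that(2) by linarith
  qed
  ultimately show ?thesis by blast
qed (auto intro: exI[of _ 1])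

lemma tendsto_at_top_if_unique_cluster_point:
  fixes x :: "real \<Rightarrow> 'a::metric_space"
  assumes "compact S" "\<And>t. t \<ge> 0 \<Longrightarrow> x t \<in> S"
    and unique: "\<And>t p. filterlim t at_top sequentially \<Longrightarrow> (\<lambda>n. x (t n)) \<longlonglongrightarrow> p \<Longrightarrow> p = l"
  shows "(x \<longlongrightarrow> l) at_top"
proof (rule ccontr)
  assume "\<not> (x \<longlongrightarrow> l) at_top"
  then obtain e where e: "e > 0" "\<And>N. \<exists>t\<ge>N. dist (x t) l \<ge> e"
    unfolding tendsto_iff eventually_at_top_linorder by (meson not_less)
  have "\<forall>n. \<exists>t\<ge>real n. dist (x t) l \<ge> e" using e(2) by blast
  then obtain t where t: "\<And>n. t n \<ge> real n" "\<And>n. dist (x (t n)) l \<ge> e"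
    by metis
  have "x (t n) \<in> S" for n
    using assms(2) t(1)[of n] by (meson of_nat_0_le_iff order_trans)
  then obtain p r where r: "strict_mono r" "((\<lambda>n. x (t n)) \<circ> r) \<longlonglongrightarrow> p"
    using \<open>compact S\<close> unfolding compact_def by meson
  have "filterlim t at_top sequentially"
    by (rule filterlim_at_top_mono[OF filterlim_real_sequentially]) (simp add: t(1))
  then have "filterlim (\<lambda>n. t (r n)) at_top sequentially"
    using filterlim_compose filterlim_subseq[OF r(1)] by blast
  moreover have lim: "(\<lambda>n. x (t (r n))) \<longlonglongrightarrow> p" using r(2) by (simp add: comp_def)
  ultimately have "p = l" by (rule unique)
  then have "\<forall>\<^sub>F n in sequentially. dist (x (t (r n))) l < e"
    using lim e(1) by (auto simp: tendsto_iff)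
  then obtain n where "dist (x (t (r n))) l < e"
    by (meson eventually_sequentially order_refl)
  then show False using t(2)[of "r n"] by linarith
qed

section \<open>Trajectories\<close>

text \<open>The last two assumptions are all that is retained of the semidefiniteness and rank
  hypotheses: the form of \<Gamma>E is nonpositive and vanishes only on the kernel of
  \<open>E\<close>.\<close>

locale dissipative_trajectory =
  fixes E :: "real^'n^'n" and \<gamma> :: "real^'n" and x :: "real \<Rightarrow> real^'n"
  assumes solution: "stubborn_neutrals_solution E x"
    and \<gamma>_pos: "\<gamma> $ i > 0"
    and dissipative: "(\<Sum>i\<in>UNIV. \<gamma> $ i * y $ i * (E *v y) $ i) \<le> 0"
    and dissipation_zero: "(\<Sum>i\<in>UNIV. \<gamma> $ i * y $ i * (E *v y) $ i) = 0 \<Longrightarrow> E *v y = 0"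
begin

text \<open>A crude bound for the entries of \<open>E *v y\<close> on the cube. The added 1 makes it
  strictly positive, so that it can be divided by.\<close>

definition K :: real where
  "K = (\<Sum>i\<in>UNIV. \<Sum>j\<in>UNIV. \<bar>E $ i $ j\<bar>) + 1"

lemma K_pos: "K > 0"
  by (simp add: K_def add_nonneg_pos sum_nonneg)

lemma in_cube: "t \<ge> 0 \<Longrightarrow> x t \<in> cbox (- 1) 1"
  using solution by (auto simp: stubborn_neutrals_solution_def mem_box_cart)

lemma abs_le_1: "t \<ge> 0 \<Longrightarrow> \<bar>x t $ i\<bar> \<le> 1"
  using in_cube[of t] by (auto simp: mem_box_cart abs_le_iff minus_le_iff)

lemma abs_E_le:
  assumes "y \<in> cbox (- 1) 1"
  shows "\<bar>(E *v y) $ i\<bar> \<le> K"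
proof -
  have y: "\<bar>y $ j\<bar> \<le> 1" for j
    using assms by (auto simp: mem_box_cart abs_le_iff minus_le_iff)
  have "\<bar>(E *v y) $ i\<bar> \<le> (\<Sum>j\<in>UNIV. \<bar>E $ i $ j * y $ j\<bar>)"
    by (simp add: matrix_vector_mult_def)
  also have "\<dots> \<le> (\<Sum>j\<in>UNIV. \<bar>E $ i $ j\<bar>)"
    by (rule sum_mono) (simp add: abs_mult mult_left_le y)
  also have "\<dots> \<le> (\<Sum>i\<in>UNIV. \<Sum>j\<in>UNIV. \<bar>E $ i $ j\<bar>)"
    by (rule member_le_sum[where f = "\<lambda>i. \<Sum>j\<in>UNIV. \<bar>E $ i $ j\<bar>"]) (auto intro: sum_nonneg)
  finally show ?thesis by (simp add: K_def)
qed

lemma component_deriv: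
  assumes "t \<ge> 0"
  shows "((\<lambda>t. x t $ i) has_real_derivative (x t $ i)\<^sup>2 * (E *v x t) $ i) (at t within {0..})"
proof -
  have "(x has_vector_derivative ((diag_mat (x t) ** diag_mat (x t)) *v (E *v x t))) (at t within {0..})"
    using solution assms by (simp add: stubborn_neutrals_solution_def)
  from bounded_linear.has_vector_derivative[OF bounded_linear_vec_nth this, of i]
  show ?thesis
    by (simp add: has_real_derivative_iff_has_vector_derivative matrix_vector_mul_assoc[symmetric]
        diag_mat_vec_mult power2_eq_square mult_ac)
qed

section \<open>Growth bounds and invariance of signs\<close>

lemma square_deriv_bound:
  assumes "t \<ge> 0"
  shows "\<bar>2 * x t $ i * ((x t $ i)\<^sup>2 * (E *v x t) $ i)\<bar> \<le> 2 * K * (x t $ i)\<^sup>2"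
proof -
  have "\<bar>x t $ i\<bar> * \<bar>(E *v x t) $ i\<bar> \<le> 1 * K"
    by (intro mult_mono abs_le_1 abs_E_le in_cube assms) auto
  from mult_left_mono[OF this, of "2 * (x t $ i)\<^sup>2"]
  show ?thesis by (simp add: abs_mult mult_ac)
qed

text \<open>Gronwall in both time directions: the square times \<open>exp (- 2 * K * t)\<close> is
  nonincreasing, times \<open>exp (2 * K * t)\<close> nondecreasing. So a coordinate neither reaches
  nor leaves zero, and a small one stays small over a bounded window into the past.\<close>

lemma square_growth:
  assumes "0 \<le> s" "s \<le> t"
  shows "(x t $ i)\<^sup>2 \<le> (x s $ i)\<^sup>2 * exp (2 * K * (t - s))"
    and "(x s $ i)\<^sup>2 \<le> (x t $ i)\<^sup>2 * exp (2 * K * (t - s))"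
proof -
  let ?d = "\<lambda>u. 2 * x u $ i * ((x u $ i)\<^sup>2 * (E *v x u) $ i)"
  have d: "((\<lambda>u. (x u $ i)\<^sup>2 * exp (c * u)) has_real_derivative
      (?d u + c * (x u $ i)\<^sup>2) * exp (c * u)) (at u within {0..})" if "u \<ge> 0" for u c
    by (auto intro!: derivative_eq_intros component_deriv that simp: algebra_simps)
  have "(x t $ i)\<^sup>2 * exp (- 2 * K * t) \<le> (x s $ i)\<^sup>2 * exp (- 2 * K * s) + 0 * (t - s)"
  proof (rule derivative_bound_imp_increment_bound[OF assms(2,1) d])
    fix u assume "s \<le> u"
    then have "?d u + - 2 * K * (x u $ i)\<^sup>2 \<le> 0"
      using square_deriv_bound[of u i] assms(1) by linarith
    then show "(?d u + - 2 * K * (x u $ i)\<^sup>2) * exp (- 2 * K * u) \<le> 0"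
      by (rule mult_nonpos_nonneg) simp
  qed
  then have "(x t $ i)\<^sup>2 * exp (- 2 * K * t) * exp (2 * K * t)
      \<le> (x s $ i)\<^sup>2 * exp (- 2 * K * s) * exp (2 * K * t)"
    by simp
  then show "(x t $ i)\<^sup>2 \<le> (x s $ i)\<^sup>2 * exp (2 * K * (t - s))"
    by (simp add: mult.assoc exp_add[symmetric] algebra_simps del: mult_le_cancel_right)
  have "- ((x t $ i)\<^sup>2 * exp (2 * K * t)) \<le> - ((x s $ i)\<^sup>2 * exp (2 * K * s)) + 0 * (t - s)"
  proof (rule derivative_bound_imp_increment_bound[OF assms(2,1) DERIV_minus[OF d]])
    fix u assume "s \<le> u"
    then have "?d u + 2 * K * (x u $ i)\<^sup>2 \<ge> 0"
      using square_deriv_bound[of u i] assms(1) by linarith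
    then have "(?d u + 2 * K * (x u $ i)\<^sup>2) * exp (2 * K * u) \<ge> 0"
      by (rule mult_nonneg_nonneg) simp
    then show "- ((?d u + 2 * K * (x u $ i)\<^sup>2) * exp (2 * K * u)) \<le> 0"
      by simp
  qed
  then have "(x s $ i)\<^sup>2 * exp (2 * K * s) * exp (- 2 * K * s)
      \<le> (x t $ i)\<^sup>2 * exp (2 * K * t) * exp (- 2 * K * s)"
    by simp
  then show "(x s $ i)\<^sup>2 \<le> (x t $ i)\<^sup>2 * exp (2 * K * (t - s))"
    by (simp add: mult.assoc exp_add[symmetric] algebra_simps del: mult_le_cancel_right)
qed

lemma component_continuous: "continuous_on {0..} (\<lambda>t. x t $ i)"
  by (rule DERIV_continuous_on) (use component_deriv in auto)

lemma zero_iff: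
  assumes "s \<ge> 0" "t \<ge> 0"
  shows "x s $ i = 0 \<longleftrightarrow> x t $ i = 0"
proof -
  have "x s $ i = 0 \<longleftrightarrow> x t $ i = 0" if "0 \<le> s" "s \<le> t" for s t
    using square_growth[OF that, of i] by auto
  then show ?thesis using assms by (meson linear)
qed

text \<open>A change of sign would force a zero by the intermediate value theorem, and then the
  coordinate would vanish at all times.\<close>

lemma same_sign:
  assumes "s \<ge> 0" "t \<ge> 0" "x s $ i \<noteq> 0"
  shows "x s $ i * x t $ i > 0"
proof (rule ccontr)
  assume "\<not> x s $ i * x t $ i > 0"
  then have neg: "x s $ i * x t $ i \<le> 0" by simp
  have "continuous_on {0..} (\<lambda>u. x s $ i * x u $ i)"
    by (intro continuous_intros component_continuous)
  note interval = connected_iff_interval[THEN iffD1, OF connected_continuous_image[OF this connected_Ici]]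
  have "0 \<in> (\<lambda>u. x s $ i * x u $ i) ` {0..}"
    by (rule interval[rule_format, of "x s $ i * x t $ i" "x s $ i * x s $ i"]) (use neg assms in auto)
  then obtain u where "u \<ge> 0" "x u $ i = 0"
    using assms(3) by auto
  then show False using zero_iff[of s u i] assms by simp
qed

text \<open>Written with the logarithm of the square so that the sign of the entry is irrelevant.\<close>

lemma log_deriv:
  assumes "\<And>i. i \<in> T \<Longrightarrow> x 0 $ i \<noteq> 0" "t \<ge> 0"
  shows "((\<lambda>t. \<Sum>i\<in>T. \<gamma> $ i / 2 * ln ((x t $ i)\<^sup>2)) has_real_derivative
      (\<Sum>i\<in>T. \<gamma> $ i * x t $ i * (E *v x t) $ i)) (at t within {0..})"
proof (rule DERIV_sum)
  fix i assume "i \<in> T"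
  then have "x t $ i \<noteq> 0"
    using zero_iff[of 0 t i] assms by auto
  moreover from this have "x t $ i * x t $ i > 0"
    using not_real_square_gt_zero by blast
  ultimately show "((\<lambda>t. \<gamma> $ i / 2 * ln ((x t $ i)\<^sup>2)) has_real_derivative
      \<gamma> $ i * x t $ i * (E *v x t) $ i) (at t within {0..})"
    by (auto intro!: derivative_eq_intros component_deriv assms simp: field_simps power2_eq_square)
qed

section \<open>Bounds on the logarithmic functional and supports of cluster points\<close>

lemma continuous_dissipation:
  "continuous_on S (\<lambda>y. \<Sum>i\<in>T. \<gamma> $ i * y $ i * (E *v y) $ i)"
  by (intro continuous_intros linear_continuous_on bounded_linear.continuous_on[OF bounded_linear_vec_nth]
      matrix_vector_mul_bounded_linear)

lemma log_term_nonpos: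
  assumes "\<bar>a\<bar> \<le> 1"
  shows "\<gamma> $ i / 2 * ln (a\<^sup>2) \<le> 0"
proof -
  \<comment> \<open>The case \<open>a = 0\<close> rests on the default value of \<open>ln\<close> at
    0, which is 0.\<close>
  have "ln (a\<^sup>2) \<le> 0"
    using assms by (cases "a = 0") (auto simp: abs_square_le_1)
  then show ?thesis using \<gamma>_pos[of i] by (simp add: mult_nonneg_nonpos)
qed

text \<open>All summands are nonpositive in the cube, so a lower bound for the sum is one for each
  summand.\<close>

lemma log_bound_imp_square_bound:
  assumes "i \<in> T" "t \<ge> 0" "x t $ i \<noteq> 0" "(\<Sum>i\<in>T. \<gamma> $ i / 2 * ln ((x t $ i)\<^sup>2)) \<ge> w"
  shows "(x t $ i)\<^sup>2 \<ge> exp (2 * w / \<gamma> $ i)"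
proof -
  have "(\<Sum>j\<in>T - {i}. \<gamma> $ j / 2 * ln ((x t $ j)\<^sup>2)) \<le> 0"
    by (intro sum_nonpos log_term_nonpos abs_le_1 assms)
  moreover have "(\<Sum>j\<in>T. \<gamma> $ j / 2 * ln ((x t $ j)\<^sup>2)) =
      \<gamma> $ i / 2 * ln ((x t $ i)\<^sup>2) + (\<Sum>j\<in>T - {i}. \<gamma> $ j / 2 * ln ((x t $ j)\<^sup>2))"
    using assms(1) by (intro sum.remove) auto
  ultimately have "w \<le> \<gamma> $ i / 2 * ln ((x t $ i)\<^sup>2)"
    using assms(4) by simp
  then have "2 * w / \<gamma> $ i \<le> ln ((x t $ i)\<^sup>2)"
    using \<gamma>_pos[of i] by (simp add: field_simps)
  then show ?thesis
    using assms(3) by (simp add: ln_ge_iff)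
qed

text \<open>The kernel element below is found by following the trajectory backwards from times at which it is
  close to the cluster point. The logarithmic functional restricted to the support of the cluster
  point is almost nonincreasing in forward time, so over a long backward window it stays bounded
  below; if the dissipation were bounded away from zero there, it would become positive.\<close>

lemma cluster_point_support:
  assumes t: "filterlim t at_top sequentially" and p: "(\<lambda>n. x (t n)) \<longlonglongrightarrow> p"
  shows "\<exists>q. E *v q = 0 \<and> (\<forall>i. p $ i = 0 \<longrightarrow> q $ i = 0) \<and> (\<forall>i. p $ i \<noteq> 0 \<longrightarrow> q $ i * p $ i > 0)"
proof (rule ccontr)
  assume no_q: "\<not> ?thesis"
  define T where "T = {i. p $ i \<noteq> 0}"
  define F where "F = (\<lambda>y. \<Sum>i\<in>T. \<gamma> $ i * y $ i * (E *v y) $ i)"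
  \<comment> \<open>\<open>G\<close> measures the distance to the face of vectors supported in
    \<open>T\<close>; on that face \<open>F\<close> is the full dissipation form.\<close>
  define G where "G = (\<lambda>y :: real^'n. \<Sum>i\<in>-T. (y $ i)\<^sup>2)"
  define f where "f = (\<lambda>t. \<Sum>i\<in>T. \<gamma> $ i / 2 * ln ((x t $ i)\<^sup>2))"
  define w where "w = (\<Sum>i\<in>T. \<gamma> $ i / 2 * ln ((p $ i)\<^sup>2))"
  have G_nonpos: "y $ i = 0" if "G y \<le> 0" "i \<notin> T" for y i
  proof -
    have "G y = 0"
      using that(1) unfolding G_def by (meson antisym sum_nonneg zero_le_power2)
    then have "\<forall>i\<in>-T. (y $ i)\<^sup>2 = 0"
      unfolding G_def by (subst (asm) sum_nonneg_eq_0_iff) auto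
    then show ?thesis using that(2) by auto
  qed
  have F_eq: "F y = (\<Sum>i\<in>UNIV. \<gamma> $ i * y $ i * (E *v y) $ i)" if "G y \<le> 0" for y
    unfolding F_def by (rule sum.mono_neutral_left) (use G_nonpos[OF that] in auto)
  have contF: "continuous_on S F" and contG: "continuous_on S G" for S
    unfolding F_def G_def by (rule continuous_dissipation) (intro continuous_intros)
  have p_lim: "(\<lambda>n. x (t n) $ i) \<longlonglongrightarrow> p $ i" for i
    using p by (rule tendsto_vec_nth)
  have t_ge: "\<forall>\<^sub>F n in sequentially. t n \<ge> c" for c
    using t by (simp add: filterlim_at_top)
  have p_cube: "p \<in> cbox (- 1) 1"
    by (rule Lim_in_closed_set[OF closed_cbox _ _ p]) (auto intro: eventually_mono[OF t_ge[of 0]] in_cube)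
  have sign: "x s $ i * p $ i > 0" if "i \<in> T" "s \<ge> 0" for i s
  proof -
    have "(\<lambda>n. x (t n) $ i * p $ i) \<longlonglongrightarrow> p $ i * p $ i"
      by (intro tendsto_intros p_lim)
    moreover have "p $ i \<noteq> 0" using that(1) by (simp add: T_def)
    then have "p $ i * p $ i > 0"
      using not_real_square_gt_zero by blast
    ultimately have "\<forall>\<^sub>F n in sequentially. x (t n) $ i * p $ i > 0"
      by (rule order_tendstoD)
    with t_ge[of 0] have "\<forall>\<^sub>F n in sequentially. x (t n) $ i * p $ i > 0 \<and> t n \<ge> 0"
      by eventually_elim auto
    then obtain n where n: "x (t n) $ i * p $ i > 0" "t n \<ge> 0"
      using eventually_happens'[OF sequentially_bot] by blast
    then have "x (t n) $ i * x s $ i > 0"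
      using that by (intro same_sign) auto
    then show ?thesis using n(1) by (auto simp: zero_less_mult_iff)
  qed
  have nz: "x s $ i \<noteq> 0" if "i \<in> T" "s \<ge> 0" for i s
    using sign[OF that] by auto
  have w_nonpos: "w \<le> 0"
    unfolding w_def using p_cube
    by (intro sum_nonpos log_term_nonpos) (auto simp: mem_box_cart abs_le_iff minus_le_iff)
  have f_nonpos: "f s \<le> 0" if "s \<ge> 0" for s
    unfolding f_def by (intro sum_nonpos log_term_nonpos abs_le_1 that)
  \<comment> \<open>States with the signs of \<open>p\<close> on \<open>T\<close> and those
    coordinates bounded away from zero. Of the slack 2, one unit is for \<open>f (t n)\<close>
    against its limit \<open>w\<close>, the other for the growth of \<open>f\<close> over the
    backward window.\<close>
  define S where "S = cbox (- 1) 1 \<inter>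
    (\<Inter>i\<in>T. {y. y $ i * p $ i \<ge> 0} \<inter> {y. (y $ i)\<^sup>2 \<ge> exp (2 * (w - 2) / \<gamma> $ i)})"
  have "closed (\<Inter>i\<in>T. {y::real^'n. y $ i * p $ i \<ge> 0} \<inter> {y. (y $ i)\<^sup>2 \<ge> exp (2 * (w - 2) / \<gamma> $ i)})"
    by (intro closed_INT ballI closed_Int closed_Collect_le continuous_intros)
  then have "compact S"
    unfolding S_def by (intro compact_Int_closed compact_cbox)
  \<comment> \<open>A point of \<open>S\<close> on the face has exactly the sign pattern of
    \<open>p\<close>, so by \<open>no_q\<close> it is not in the kernel and its dissipation is
    strictly negative.\<close>
  have "\<exists>\<delta>>0. \<forall>y\<in>S. G y < \<delta> \<longrightarrow> F y \<le> - \<delta>"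
  proof (rule compact_uniformly_negative[OF \<open>compact S\<close> contF contG])
    fix y assume y: "y \<in> S" "G y \<le> 0"
    have "y $ i * p $ i > 0" if "i \<in> T" for i
    proof -
      have "(y $ i)\<^sup>2 \<ge> exp (2 * (w - 2) / \<gamma> $ i)" and nonneg: "y $ i * p $ i \<ge> 0"
        using y(1) that by (auto simp: S_def)
      then have "y $ i \<noteq> 0"
        by (metis exp_gt_zero linorder_not_le zero_power2)
      then show ?thesis using nonneg that by (auto simp: T_def less_le)
    qed
    then have "E *v y \<noteq> 0"
      using no_q G_nonpos[OF y(2)] by (auto simp: T_def)
    then show "F y < 0"
      using dissipative[of y] dissipation_zero[of y] F_eq[OF y(2)] by fastforce
  qed
  then obtain \<delta> where \<delta>: "\<delta> > 0" "\<And>y. y \<in> S \<Longrightarrow> G y < \<delta> \<Longrightarrow> F y \<le> - \<delta>" by blast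
  \<comment> \<open>Window length for which dissipation at rate \<delta> lowers \<open>f\<close> by
    \<open>2 - w\<close>, more than its upper bound 0 allows.\<close>
  define L where "L = (2 - w) / \<delta>"
  have L: "L > 0" "\<delta> * L = 2 - w" using w_nonpos \<delta>(1) by (auto simp: L_def)
  \<comment> \<open>Membership in \<open>S\<close> is not yet known along the window, so a weaker
    bound on the whole cube comes first: near the face \<open>f\<close> grows at rate at most
    \<open>1 / L\<close>, hence by at most 1 over the window.\<close>
  have "\<exists>\<epsilon>>0. \<forall>y\<in>cbox (- 1) 1. G y < \<epsilon> \<longrightarrow> F y - 1 / L \<le> - \<epsilon>"
  proof (rule compact_uniformly_negative[OF compact_cbox _ contG])
    show "continuous_on (cbox (- 1) 1) (\<lambda>y. F y - 1 / L)"
      by (intro continuous_intros contF)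
    fix y assume "G y \<le> 0"
    then have "F y \<le> 0" using F_eq dissipative by simp
    then show "F y - 1 / L < 0" using L(1) by (simp add: le_less_trans)
  qed
  then obtain \<epsilon> where \<epsilon>: "\<epsilon> > 0" "\<And>y. y \<in> cbox (- 1) 1 \<Longrightarrow> G y < \<epsilon> \<Longrightarrow> F y - 1 / L \<le> - \<epsilon>"
    by blast
  \<comment> \<open>The factor \<open>exp (2 * K * L)\<close> pays for the possible size of the
    coordinates outside \<open>T\<close> at earlier times in the window.\<close>
  have "(\<lambda>n. G (x (t n)) * exp (2 * K * L)) \<longlonglongrightarrow> G p * exp (2 * K * L)"
    unfolding G_def by (intro tendsto_intros p_lim)
  moreover have "G p = 0" by (simp add: G_def T_def)
  ultimately have "\<forall>\<^sub>F n in sequentially. G (x (t n)) * exp (2 * K * L) < min \<delta> \<epsilon>"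
    using \<delta>(1) \<epsilon>(1) by (intro order_tendstoD) auto
  moreover have "(\<lambda>n. f (t n)) \<longlonglongrightarrow> w"
    unfolding f_def w_def by (intro tendsto_intros p_lim) (auto simp: T_def)
  then have "\<forall>\<^sub>F n in sequentially. f (t n) > w - 1"
    by (rule order_tendstoD) simp
  ultimately have "\<forall>\<^sub>F n in sequentially.
      G (x (t n)) * exp (2 * K * L) < min \<delta> \<epsilon> \<and> f (t n) > w - 1 \<and> t n \<ge> L"
    using t_ge[of L] by eventually_elim auto
  then obtain n where n: "G (x (t n)) * exp (2 * K * L) < min \<delta> \<epsilon>" "f (t n) > w - 1" "t n \<ge> L"
    using eventually_happens'[OF sequentially_bot] by blast
  have G_small: "G (x s) < min \<delta> \<epsilon>" if "t n - L \<le> s" "s \<le> t n" for s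
  proof -
    have s: "s \<ge> 0" using that n(3) by linarith
    have "G (x s) \<le> (\<Sum>i\<in>-T. (x (t n) $ i)\<^sup>2 * exp (2 * K * L))"
      unfolding G_def
    proof (rule sum_mono)
      fix i
      have "(x s $ i)\<^sup>2 \<le> (x (t n) $ i)\<^sup>2 * exp (2 * K * (t n - s))"
        by (rule square_growth(2)[OF s that(2)])
      also have "\<dots> \<le> (x (t n) $ i)\<^sup>2 * exp (2 * K * L)"
        using that K_pos by (intro mult_left_mono) auto
      finally show "(x s $ i)\<^sup>2 \<le> (x (t n) $ i)\<^sup>2 * exp (2 * K * L)" .
    qed
    also have "\<dots> = G (x (t n)) * exp (2 * K * L)"
      by (simp add: G_def sum_distrib_right)
    finally show ?thesis using n(1) by linarith
  qed
  have df: "(f has_real_derivative F (x s)) (at s within {0..})" if "s \<ge> 0" for s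
    unfolding f_def F_def by (rule log_deriv[OF nz that]) auto
  have in_S: "x s \<in> S" if s: "t n - L \<le> s" "s \<le> t n" for s
  proof -
    have s0: "s \<ge> 0" using s n(3) by linarith
    have "f (t n) \<le> f s + 1 / L * (t n - s)"
    proof (rule derivative_bound_imp_increment_bound[OF s(2) s0 df])
      fix u assume "s \<le> u" "u \<le> t n"
      then show "F (x u) \<le> 1 / L"
        using \<epsilon>(2)[of "x u"] in_cube[of u] G_small[of u] s s0 \<epsilon>(1) by auto
    qed
    also have "1 / L * (t n - s) \<le> 1"
      using s L(1) by (simp add: field_simps)
    finally have f_ge: "f s \<ge> w - 2" using n(2) by linarith
    have "(x s $ i)\<^sup>2 \<ge> exp (2 * (w - 2) / \<gamma> $ i)" if "i \<in> T" for i
      by (rule log_bound_imp_square_bound[OF that s0 nz[OF that s0]]) (use f_ge in \<open>simp only: f_def\<close>)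
    then show ?thesis
      using in_cube[OF s0] sign[OF _ s0] by (auto simp: S_def less_imp_le)
  qed
  \<comment> \<open>The whole window now lies in \<open>S\<close> near the face, so the rate
    \<delta> applies throughout. As \<open>f (t n - L)\<close> is at most 0, \<open>f (t n)\<close>
    is at most \<open>w - 2\<close>, against \<open>f (t n) > w - 1\<close>.\<close>
  have "f (t n) \<le> f (t n - L) + - \<delta> * (t n - (t n - L))"
  proof (rule derivative_bound_imp_increment_bound[OF _ _ df])
    fix u assume "t n - L \<le> u" "u \<le> t n"
    then show "F (x u) \<le> - \<delta>"
      using \<delta>(2)[OF in_S] G_small[of u] by auto
  qed (use n(3) L(1) in auto)
  then show False
    using f_nonpos[of "t n - L"] n(2,3) L(2) by simp
qed

section \<open>Convergence to the origin and to the ray of the eigenvector\<close>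

lemma lipschitz:
  assumes "0 \<le> s" "s \<le> t"
  shows "dist (x t) (x s) \<le> CARD('n) * K * (t - s)"
proof -
  have bound: "\<bar>(x u $ i)\<^sup>2 * (E *v x u) $ i\<bar> \<le> K" if "u \<ge> 0" for u i
  proof -
    have "(x u $ i)\<^sup>2 * \<bar>(E *v x u) $ i\<bar> \<le> 1 * K"
      using abs_le_1[OF that, of i] by (intro mult_mono abs_E_le in_cube that) (auto simp: abs_square_le_1)
    then show ?thesis by (simp add: abs_mult)
  qed
  then have upper: "(x u $ i)\<^sup>2 * (E *v x u) $ i \<le> K"
    and lower: "- ((x u $ i)\<^sup>2 * (E *v x u) $ i) \<le> K" if "u \<ge> 0" for u i
    using that by (meson abs_le_D1, meson abs_le_D2)
  have "\<bar>x t $ i - x s $ i\<bar> \<le> K * (t - s)" for i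
  proof -
    have "x t $ i \<le> x s $ i + K * (t - s)"
      by (rule derivative_bound_imp_increment_bound[OF assms(2,1) component_deriv])
        (use assms(1) in \<open>auto intro: upper\<close>)
    moreover have "- x t $ i \<le> - x s $ i + K * (t - s)"
      by (rule derivative_bound_imp_increment_bound[OF assms(2,1) DERIV_minus[OF component_deriv]])
        (use assms(1) in \<open>auto intro: lower\<close>)
    ultimately show ?thesis by (simp add: abs_le_iff)
  qed
  then have "(\<Sum>i\<in>UNIV. \<bar>(x t - x s) $ i\<bar>) \<le> (\<Sum>i\<in>(UNIV::'n set). K * (t - s))"
    by (intro sum_mono) simp
  then show ?thesis
    using norm_le_l1_cart[of "x t - x s"] by (simp add: dist_norm mult.assoc)
qed

text \<open>Nonzero coordinates of a cluster point keep the initial sign. The kernel vector attached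
  to its support therefore meets the hypothesis \<open>kernel\<close> and is zero, so the support is
  empty.\<close>

lemma tendsto_zero:
  assumes kernel: "\<And>q. E *v q = 0 \<Longrightarrow> (\<And>i. q $ i \<noteq> 0 \<Longrightarrow> x 0 $ i * q $ i > 0) \<Longrightarrow> q = 0"
  shows "(x \<longlongrightarrow> 0) at_top"
proof (rule tendsto_at_top_if_unique_cluster_point[OF compact_cbox in_cube])
  fix t p assume t: "filterlim t at_top sequentially" and p: "(\<lambda>n. x (t n)) \<longlonglongrightarrow> p"
  have ev: "\<forall>\<^sub>F n in sequentially. t n \<ge> 0"
    using t by (simp add: filterlim_at_top)
  have p_sign: "x 0 $ i * p $ i > 0" if "p $ i \<noteq> 0" for i
  proof -
    have lim: "(\<lambda>n. x (t n) $ i) \<longlonglongrightarrow> p $ i"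
      using p by (rule tendsto_vec_nth)
    have "x 0 $ i \<noteq> 0"
    proof
      assume "x 0 $ i = 0"
      then have "\<forall>\<^sub>F n in sequentially. x (t n) $ i = 0"
        by (intro eventually_mono[OF ev]) (use zero_iff[of 0] in auto)
      then have "(\<lambda>n. x (t n) $ i) \<longlonglongrightarrow> 0"
        by (rule tendsto_eventually)
      then show False using lim that LIMSEQ_unique by blast
    qed
    then have "\<forall>\<^sub>F n in sequentially. 0 \<le> x 0 $ i * x (t n) $ i"
      by (intro eventually_mono[OF ev] less_imp_le[OF same_sign]) auto
    then have "0 \<le> x 0 $ i * p $ i"
      by (rule tendsto_lowerbound[OF tendsto_mult_left[OF lim]]) simp
    then show ?thesis using that \<open>x 0 $ i \<noteq> 0\<close> by (simp add: less_le)
  qed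
  obtain q where q: "E *v q = 0" "\<And>i. p $ i = 0 \<Longrightarrow> q $ i = 0" "\<And>i. p $ i \<noteq> 0 \<Longrightarrow> q $ i * p $ i > 0"
    using cluster_point_support[OF t p] by blast
  have "q = 0"
  proof (rule kernel[OF q(1)])
    fix i assume "q $ i \<noteq> 0"
    then have "p $ i \<noteq> 0" using q(2) by blast
    from q(3)[OF this] p_sign[OF this] show "x 0 $ i * q $ i > 0"
      by (auto simp: zero_less_mult_iff)
  qed
  then have "p $ i = 0" for i
    using q(3)[of i] by (cases "p $ i = 0") auto
  then show "p = 0" by (simp add: vec_eq_iff)
qed

text \<open>LaSalle-type argument: \<open>f\<close> is nonincreasing and bounded below, yet with
  negative dissipation at \<open>p\<close> every visit near \<open>p\<close> would cost a fixed
  amount of \<open>f\<close>.\<close>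

lemma dissipation_vanishes_at_cluster_point:
  assumes x0: "\<And>i. x 0 $ i \<noteq> 0"
    and below: "\<And>t. t \<ge> 0 \<Longrightarrow> b \<le> (\<Sum>i\<in>UNIV. \<gamma> $ i / 2 * ln ((x t $ i)\<^sup>2))"
    and t: "filterlim t at_top sequentially" and p: "(\<lambda>n. x (t n)) \<longlonglongrightarrow> p"
  shows "E *v p = 0"
proof (rule ccontr)
  assume nz: "E *v p \<noteq> 0"
  define f where "f = (\<lambda>t. \<Sum>i\<in>UNIV. \<gamma> $ i / 2 * ln ((x t $ i)\<^sup>2))"
  define Q where "Q = (\<lambda>y. \<Sum>i\<in>UNIV. \<gamma> $ i * y $ i * (E *v y) $ i)"
  have df: "(f has_real_derivative Q (x s)) (at s within {0..})" if "s \<ge> 0" for s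
    unfolding f_def Q_def by (rule log_deriv[OF x0 that])
  define \<delta> where "\<delta> = - Q p / 2"
  have \<delta>: "\<delta> > 0" "Q p < - \<delta>"
    using dissipative[of p] dissipation_zero[of p] nz by (auto simp: \<delta>_def Q_def less_le)
  have "continuous_on UNIV Q" unfolding Q_def by (rule continuous_dissipation)
  then have "(Q \<longlongrightarrow> Q p) (nhds p)"
    by (simp add: continuous_on_eq_continuous_at isCont_def tendsto_at_iff_tendsto_nhds)
  then have "\<forall>\<^sub>F y in nhds p. Q y < - \<delta>"
    using \<delta>(2) by (rule order_tendstoD)
  then obtain r where r: "r > 0" "\<And>y. dist y p < r \<Longrightarrow> Q y < - \<delta>"
    unfolding eventually_nhds_metric by blast
  \<comment> \<open>By the speed bound, the trajectory moves at most \<open>r / 2\<close> during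
    time \<tau>, so from within \<open>r / 2\<close> of \<open>p\<close> it stays within
    \<open>r\<close>.\<close>
  define \<tau> where "\<tau> = r / (2 * CARD('n) * K)"
  have \<tau>: "\<tau> > 0" "CARD('n) * K * \<tau> = r / 2"
    using r(1) K_pos by (auto simp: \<tau>_def)
  have bdd: "bdd_below (f ` {0..})"
    using below by (auto simp: bdd_below_def f_def)
  have decreasing: "f s' \<le> f s" if "0 \<le> s" "s \<le> s'" for s s'
  proof -
    have "f s' \<le> f s + 0 * (s' - s)"
      by (rule derivative_bound_imp_increment_bound[OF that(2,1) df]) (auto simp: Q_def dissipative)
    then show ?thesis by simp
  qed
  \<comment> \<open>After \<open>s0\<close> one further drop by \<open>\<delta> * \<tau>\<close>
    takes \<open>f\<close> below its infimum.\<close>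
  have "\<exists>z\<in>f ` {0..}. z < Inf (f ` {0..}) + \<delta> * \<tau>"
    using \<delta>(1) \<tau>(1) by (intro cInf_lessD) auto
  then obtain s0 where s0: "s0 \<ge> 0" "f s0 < Inf (f ` {0..}) + \<delta> * \<tau>" by auto
  have "\<forall>\<^sub>F n in sequentially. dist (x (t n)) p < r / 2"
    using tendstoD[OF p, of "r / 2"] r(1) by simp
  moreover have "\<forall>\<^sub>F n in sequentially. t n \<ge> s0"
    using t by (simp add: filterlim_at_top)
  ultimately have "\<forall>\<^sub>F n in sequentially. dist (x (t n)) p < r / 2 \<and> t n \<ge> s0"
    by eventually_elim auto
  then obtain n where n: "dist (x (t n)) p < r / 2" "t n \<ge> s0"
    using eventually_happens'[OF sequentially_bot] by blast
  have tn: "t n \<ge> 0" using n(2) s0(1) by linarith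
  have "f (t n + \<tau>) \<le> f (t n) + - \<delta> * (t n + \<tau> - t n)"
  proof (rule derivative_bound_imp_increment_bound[OF _ tn df])
    fix s assume s: "t n \<le> s" "s \<le> t n + \<tau>"
    have "dist (x s) (x (t n)) \<le> CARD('n) * K * (s - t n)"
      by (rule lipschitz[OF tn s(1)])
    also have "\<dots> \<le> CARD('n) * K * \<tau>"
      using s K_pos by (intro mult_left_mono) auto
    finally have "dist (x s) p < r"
      using n(1) \<tau>(2) dist_triangle[of "x s" p "x (t n)"] by linarith
    then show "Q (x s) \<le> - \<delta>" using r(2) by (simp add: less_imp_le)
  qed (use \<tau>(1) in auto)
  moreover have "f (t n) \<le> f s0" by (rule decreasing[OF s0(1) n(2)])
  moreover have "Inf (f ` {0..}) \<le> f (t n + \<tau>)"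
    using tn \<tau>(1) by (intro cInf_lower bdd) auto
  ultimately show False using s0(2) by simp
qed

lemma tendsto_positive_eigenvector:
  assumes v: "\<And>i. v $ i > 0"
    and left_null: "\<And>y. (\<Sum>i\<in>UNIV. \<gamma> $ i * v $ i * (E *v y) $ i) = 0"
    and kernel: "\<And>q. E *v q = 0 \<Longrightarrow> \<exists>a. q = a *\<^sub>R v"
    and x0: "\<And>i. x 0 $ i > 0"
  shows "\<exists>\<alpha>\<in>{0<..1 / infnorm v}. (x \<longlongrightarrow> \<alpha> *\<^sub>R v) at_top"
proof -
  define Z where "Z = (\<lambda>t. \<Sum>i\<in>UNIV. \<gamma> $ i * v $ i / x t $ i)"
  have pos: "x t $ i > 0" if "t \<ge> 0" for t i
    using same_sign[of 0 t i] x0[of i] that by (auto simp: zero_less_mult_iff)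
  \<comment> \<open>Differentiating the reciprocal cancels the factor
    \<open>(x t $ i)\<^sup>2\<close> of the dynamics; what remains is linear in
    \<open>E *v x t\<close> and vanishes by \<open>left_null\<close>.\<close>
  have dZ: "(Z has_real_derivative 0) (at t within {0..})" if "t \<ge> 0" for t
  proof -
    have "(Z has_real_derivative (\<Sum>i\<in>UNIV. - (\<gamma> $ i * v $ i * (E *v x t) $ i))) (at t within {0..})"
      unfolding Z_def
    proof (rule DERIV_sum)
      fix i
      show "((\<lambda>t. \<gamma> $ i * v $ i / x t $ i) has_real_derivative - (\<gamma> $ i * v $ i * (E *v x t) $ i))
          (at t within {0..})"
        using pos[OF that, of i]
        by (auto intro!: derivative_eq_intros component_deriv that simp: field_simps power2_eq_square)
    qed
    then show ?thesis by (simp add: sum_negf left_null)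
  qed
  have Z_const: "Z t = Z 0" if "t \<ge> 0" for t
  proof -
    have "Z t \<le> Z 0 + 0 * (t - 0)"
      by (rule derivative_bound_imp_increment_bound[OF that _ dZ]) auto
    moreover have "- Z t \<le> - Z 0 + 0 * (t - 0)"
      by (rule derivative_bound_imp_increment_bound[OF that _ DERIV_minus[OF dZ]]) auto
    ultimately show ?thesis by simp
  qed
  have term_pos: "\<gamma> $ i * v $ i / x t $ i > 0" if "t \<ge> 0" for t i
    using \<gamma>_pos[of i] v[of i] pos[OF that, of i] by simp
  have Z_pos: "Z 0 > 0"
    unfolding Z_def by (rule sum_pos) (auto intro: term_pos)
  \<comment> \<open>Each positive summand of the constant \<open>Z\<close> is at most
    \<open>Z 0\<close>, which bounds \<open>x t $ i\<close> below by \<open>m i\<close>.\<close>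
  define m where "m = (\<lambda>i. \<gamma> $ i * v $ i / Z 0)"
  have m_pos: "m i > 0" for i
    using \<gamma>_pos[of i] v[of i] Z_pos by (simp add: m_def)
  have ge_m: "x t $ i \<ge> m i" if "t \<ge> 0" for t i
  proof -
    have "\<gamma> $ i * v $ i / x t $ i \<le> Z t"
      unfolding Z_def by (rule member_le_sum) (auto intro: less_imp_le term_pos that)
    then show ?thesis
      using Z_const[OF that] Z_pos pos[OF that, of i] by (simp add: m_def field_simps)
  qed
  \<comment> \<open>The only multiple \<open>a *\<^sub>R v\<close> with \<open>a > 0\<close> at
    which the conserved sum has the value \<open>Z 0\<close>.\<close>
  define \<alpha> where "\<alpha> = (\<Sum>i\<in>UNIV. \<gamma> $ i) / Z 0"
  have \<alpha>_pos: "\<alpha> > 0"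
    unfolding \<alpha>_def by (intro divide_pos_pos sum_pos Z_pos) (auto simp: \<gamma>_pos)
  have lim: "(x \<longlongrightarrow> \<alpha> *\<^sub>R v) at_top"
  proof (rule tendsto_at_top_if_unique_cluster_point[OF compact_cbox in_cube])
    fix t p assume t: "filterlim t at_top sequentially" and p: "(\<lambda>n. x (t n)) \<longlonglongrightarrow> p"
    have ev: "\<forall>\<^sub>F n in sequentially. t n \<ge> 0"
      using t by (simp add: filterlim_at_top)
    have p_lim: "(\<lambda>n. x (t n) $ i) \<longlonglongrightarrow> p $ i" for i
      using p by (rule tendsto_vec_nth)
    have "E *v p = 0"
    proof (rule dissipation_vanishes_at_cluster_point[OF _ _ t p])
      show "x 0 $ i \<noteq> 0" for i using x0[of i] by simp
      show "(\<Sum>i\<in>UNIV. \<gamma> $ i / 2 * ln ((m i)\<^sup>2)) \<le> (\<Sum>i\<in>UNIV. \<gamma> $ i / 2 * ln ((x t $ i)\<^sup>2))"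
        if "t \<ge> 0" for t
      proof (rule sum_mono)
        fix i
        have "(m i)\<^sup>2 \<le> (x t $ i)\<^sup>2"
          by (intro power_mono ge_m that less_imp_le m_pos)
        then have "ln ((m i)\<^sup>2) \<le> ln ((x t $ i)\<^sup>2)"
          using m_pos[of i] pos[OF that, of i] by simp
        then show "\<gamma> $ i / 2 * ln ((m i)\<^sup>2) \<le> \<gamma> $ i / 2 * ln ((x t $ i)\<^sup>2)"
          using \<gamma>_pos[of i] by (intro mult_left_mono) auto
      qed
    qed
    then obtain a where a: "p = a *\<^sub>R v" using kernel by blast
    have p_pos: "p $ i > 0" for i
    proof -
      have "m i \<le> p $ i"
        by (rule tendsto_lowerbound[OF p_lim eventually_mono[OF ev ge_m]])
          (simp_all add: sequentially_bot)
      then show ?thesis using m_pos[of i] by linarith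
    qed
    \<comment> \<open>\<open>undefined\<close> serves as an arbitrary index.\<close>
    have a_pos: "a > 0"
      using p_pos[of undefined] v[of undefined] by (auto simp: a zero_less_mult_iff)
    have "(\<lambda>n. Z (t n)) \<longlonglongrightarrow> (\<Sum>i\<in>UNIV. \<gamma> $ i * v $ i / p $ i)"
      unfolding Z_def by (intro tendsto_intros p_lim) (simp add: less_imp_neq[OF p_pos, symmetric])
    moreover have "\<forall>\<^sub>F n in sequentially. Z (t n) = Z 0"
      using ev by eventually_elim (rule Z_const)
    then have "(\<lambda>n. Z (t n)) \<longlonglongrightarrow> Z 0"
      by (rule tendsto_eventually)
    ultimately have "Z 0 = (\<Sum>i\<in>UNIV. \<gamma> $ i * v $ i / p $ i)"
      using LIMSEQ_unique by blast
    also have "\<dots> = (\<Sum>i\<in>UNIV. \<gamma> $ i / a)"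
    proof (rule sum.cong)
      fix i
      show "\<gamma> $ i * v $ i / p $ i = \<gamma> $ i / a" using v[of i] by (simp add: a)
    qed simp
    also have "\<dots> = (\<Sum>i\<in>UNIV. \<gamma> $ i) / a"
      by (simp add: sum_divide_distrib)
    finally have "a = \<alpha>"
      using a_pos Z_pos by (simp add: \<alpha>_def field_simps)
    then show "p = \<alpha> *\<^sub>R v" by (simp add: a)
  qed
  \<comment> \<open>The limit stays in the closed cube, so no entry of
    \<open>\<alpha> *\<^sub>R v\<close> exceeds 1; this is the upper bound on \<alpha>.\<close>
  have "\<alpha> *\<^sub>R v \<in> cbox (- 1) 1"
    by (rule Lim_in_closed_set[OF closed_cbox eventually_mono[OF eventually_ge_at_top[of 0] in_cube] _ lim])
      (simp_all add: trivial_limit_at_top_linorder)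
  then have "\<bar>v $ i\<bar> \<le> 1 / \<alpha>" for i
    using \<alpha>_pos v[of i] by (auto simp: mem_box_cart field_simps)
  then have "infnorm v \<le> 1 / \<alpha>"
    unfolding infnorm_vec by (intro Max.boundedI) auto
  moreover have "infnorm v > 0"
    using v by (simp add: infnorm_pos_lt vec_eq_iff) (metis less_irrefl)
  ultimately have "\<alpha> \<le> 1 / infnorm v"
    using \<alpha>_pos by (simp add: field_simps)
  then show ?thesis using lim \<alpha>_pos by auto
qed

end

section \<open>Limits of the opinion dynamics\<close>

text \<open>The vector field is odd, so the negative orthant reduces to the positive one.\<close>

lemma stubborn_neutrals_solution_uminus:
  assumes "stubborn_neutrals_solution E x"
  shows "stubborn_neutrals_solution E (\<lambda>t. - x t)"
  unfolding stubborn_neutrals_solution_def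
proof (intro conjI allI impI)
  fix t :: real assume t: "t \<ge> 0"
  have "(x has_vector_derivative ((diag_mat (x t) ** diag_mat (x t)) *v (E *v x t))) (at t within {0..})"
    using assms t by (simp add: stubborn_neutrals_solution_def)
  from has_vector_derivative_minus[OF this]
  show "((\<lambda>t. - x t) has_vector_derivative (diag_mat (- x t) ** diag_mat (- x t)) *v (E *v - x t))
      (at t within {0..})"
    by (rule back_subst[where P = "\<lambda>y. (_ has_vector_derivative y) _"])
      (simp add: vec_eq_iff matrix_vector_mul_assoc[symmetric] diag_mat_vec_mult vec.neg)
  fix i
  show "(- x t) $ i \<in> {-1..1}"
    using assms t by (fastforce simp: stubborn_neutrals_solution_def)
qed

text \<open>Common form of both assumptions: \<open>C\<close> is \<open>B\<close> with the common
  \<sigma> as \<open>d\<close>, or \<open>C_mat B \<sigma> d\<close>.\<close>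

lemma eventually_positive_shift_limits:
  fixes C :: "real^'n^'n"
  assumes E: "E = C - mat d" and C: "eventually_positive C"
    and \<gamma>: "\<And>i. \<gamma> $ i > 0"
    and neg: "neg_semidefinite (sym_part (diag_mat \<gamma> ** E))"
    and rank: "rank (sym_part (diag_mat \<gamma> ** E)) = rank E"
    and sol: "stubborn_neutrals_solution E x"
  shows "d = spectral_radius C \<Longrightarrow> positive_right_eigenvector C v \<Longrightarrow> limit_trichotomy x v"
    and "d > spectral_radius C \<Longrightarrow> (x \<longlongrightarrow> 0) at_top"
proof -
  have kernel_iff: "E *v q = 0 \<longleftrightarrow> C *v q = d *\<^sub>R q" for q
    by (simp add: E matrix_vector_mult_diff_rdistrib mat_vec_mult)
  have trajectory: "dissipative_trajectory E \<gamma> y" if "stubborn_neutrals_solution E y" for y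
  proof
    fix z
    show "(\<Sum>i\<in>UNIV. \<gamma> $ i * z $ i * (E *v z) $ i) \<le> 0"
      using neg unfolding sym_part_quadratic_form[symmetric] neg_semidefinite_def by blast
    assume "(\<Sum>i\<in>UNIV. \<gamma> $ i * z $ i * (E *v z) $ i) = 0"
    then have "sym_part (diag_mat \<gamma> ** E) *v z = 0"
      by (intro neg_semidefinite_isotropic[OF neg]) (simp only: sym_part_quadratic_form)
    then show "E *v z = 0"
      by (simp only: sym_part_kernel[OF neg rank])
  qed (use that \<gamma> in auto)
  interpret dissipative_trajectory E \<gamma> x
    by (rule trajectory[OF sol])
  show "limit_trichotomy x v" if d: "d = spectral_radius C" and "positive_right_eigenvector C v"
  proof -
    have v: "C *v v = d *\<^sub>R v" "\<And>i. v $ i > 0"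
      using that by (auto simp: positive_right_eigenvector_def)
    have kernel: "\<exists>a. q = a *\<^sub>R v" if "E *v q = 0" for q
      using eventually_positive_eigenspace[OF C v] that kernel_iff by blast
    have left_null: "(\<Sum>i\<in>UNIV. \<gamma> $ i * v $ i * (E *v y) $ i) = 0" for y
      by (rule left_null_vector[OF neg]) (simp add: kernel_iff v(1))
    show ?thesis
      unfolding limit_trichotomy_def
    proof (intro conjI impI)
      assume "\<forall>i. x 0 $ i > 0"
      then show "\<exists>\<alpha>\<in>{0<..1 / infnorm v}. (x \<longlongrightarrow> \<alpha> *\<^sub>R v) at_top"
        by (intro tendsto_positive_eigenvector v(2) left_null kernel) auto
    next
      assume "\<forall>i. x 0 $ i < 0"
      then have "\<exists>\<alpha>\<in>{0<..1 / infnorm v}. ((\<lambda>t. - x t) \<longlongrightarrow> \<alpha> *\<^sub>R v) at_top"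
        by (intro dissipative_trajectory.tendsto_positive_eigenvector[OF trajectory]
            stubborn_neutrals_solution_uminus sol v(2) left_null kernel) auto
      then obtain \<alpha> where "\<alpha> \<in> {0<..1 / infnorm v}" "((\<lambda>t. - x t) \<longlongrightarrow> \<alpha> *\<^sub>R v) at_top"
        by blast
      then show "\<exists>\<alpha>\<in>{- (1 / infnorm v)..<0}. (x \<longlongrightarrow> \<alpha> *\<^sub>R v) at_top"
        using tendsto_minus[of "\<lambda>t. - x t" "\<alpha> *\<^sub>R v" at_top] by (intro bexI[of _ "- \<alpha>"]) auto
    next
      assume mixed: "\<not> (\<forall>i. x 0 $ i > 0) \<and> \<not> (\<forall>i. x 0 $ i < 0)"
      show "(x \<longlongrightarrow> 0) at_top"
      proof (rule tendsto_zero)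
        fix q assume "E *v q = 0" and sign: "\<And>i. q $ i \<noteq> 0 \<Longrightarrow> x 0 $ i * q $ i > 0"
        then obtain a where a: "q = a *\<^sub>R v" using kernel by blast
        \<comment> \<open>A nonzero multiple of \<open>v\<close> has full support, so all entries of
          \<open>x 0\<close> would share the sign of \<open>a\<close>, contradicting
          \<open>mixed\<close>.\<close>
        show "q = 0"
        proof (rule ccontr)
          assume "q \<noteq> 0"
          then have "a \<noteq> 0" by (auto simp: a)
          then have "x 0 $ i * (a * v $ i) > 0" for i
            using sign[of i] v(2)[of i] by (simp add: a)
          then have "x 0 $ i * a > 0" for i
            using v(2)[of i] by (metis mult.assoc zero_less_mult_pos2)
          then show False
            using mixed \<open>a \<noteq> 0\<close> by (auto simp: zero_less_mult_iff neq_iff dest: less_asym)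
        qed
      qed
    qed
  qed
  show "(x \<longlongrightarrow> 0) at_top" if d: "d > spectral_radius C"
  proof (rule tendsto_zero)
    fix q assume "E *v q = 0"
    \<comment> \<open>A nonzero \<open>q\<close> would make \<open>d\<close> an eigenvalue beyond
      the spectral radius.\<close>
    then have "C *v q = d *\<^sub>R q" by (simp add: kernel_iff)
    then show "q = 0"
      using real_eigenvalue_le_spectral_radius[of C q d] d by force
  qed
qed

theorem theorem2:
  fixes B :: "real^'n^'n" and \<sigma> :: "real^'n" and x :: "real \<Rightarrow> real^'n"
  assumes "strongly_connected (with_proj (signed_digraph B))"
    and "\<forall>i. B $ i $ i = 0"
    and "\<forall>i. \<sigma> $ i > 0"
    and "\<exists>\<gamma>::real^'n. (\<forall>i. \<gamma> $ i > 0) \<and>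
           neg_semidefinite (sym_part (diag_mat \<gamma> ** E_mat B \<sigma>)) \<and>
           rank (sym_part (diag_mat \<gamma> ** E_mat B \<sigma>)) = rank (E_mat B \<sigma>)"
    and "stubborn_neutrals_solution (E_mat B \<sigma>) x"
  shows "(assumption1 B \<sigma> \<longrightarrow>
            ((\<forall>i j. \<sigma> $ i = \<sigma> $ j \<and> \<sigma> $ j = spectral_radius B) \<longrightarrow>
               (\<forall>v. positive_right_eigenvector B v \<longrightarrow> limit_trichotomy x v)) \<and>
            ((\<forall>i j. \<sigma> $ i = \<sigma> $ j \<and> \<sigma> $ j > spectral_radius B) \<longrightarrow>
               (x \<longlongrightarrow> 0) at_top)) \<and>
         (\<forall>d. assumption2 B \<sigma> d \<longrightarrow>
            (d = spectral_radius (C_mat B \<sigma> d) \<longrightarrow>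
               (\<forall>v. positive_right_eigenvector (C_mat B \<sigma> d) v \<longrightarrow> limit_trichotomy x v)) \<and>
            (d > spectral_radius (C_mat B \<sigma> d) \<longrightarrow>
               (x \<longlongrightarrow> 0) at_top))"
proof -
  from assms(4) obtain \<gamma> :: "real^'n" where \<gamma>: "\<And>i. \<gamma> $ i > 0"
    "neg_semidefinite (sym_part (diag_mat \<gamma> ** E_mat B \<sigma>))"
    "rank (sym_part (diag_mat \<gamma> ** E_mat B \<sigma>)) = rank (E_mat B \<sigma>)"
    by blast
  note limits = eventually_positive_shift_limits[OF _ _ \<gamma> assms(5)]
  \<comment> \<open>With equal entries \<Sigma> is a scalar matrix, and any index \<open>k\<close>
    supplies the shift.\<close>
  have E_uniform: "E_mat B \<sigma> = B - mat (\<sigma> $ k)" if "\<forall>i j. \<sigma> $ i = \<sigma> $ j" for k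
  proof -
    have "\<sigma> $ i = \<sigma> $ k" for i using that by blast
    then show ?thesis by (simp add: E_mat_def diag_mat_def mat_def vec_eq_iff)
  qed
  show ?thesis
  proof (intro conjI impI allI)
    fix v
    assume "assumption1 B \<sigma>" and \<sigma>: "\<forall>i j. \<sigma> $ i = \<sigma> $ j \<and> \<sigma> $ j = spectral_radius B"
      and "positive_right_eigenvector B v"
    then show "limit_trichotomy x v"
      using limits(1)[OF E_uniform] by (auto simp: assumption1_def)
  next
    assume "assumption1 B \<sigma>" and \<sigma>: "\<forall>i j. \<sigma> $ i = \<sigma> $ j \<and> \<sigma> $ j > spectral_radius B"
    then show "(x \<longlongrightarrow> 0) at_top"
      using limits(2)[OF E_uniform] by (auto simp: assumption1_def)
  next
    fix d v
    assume "assumption2 B \<sigma> d" "d = spectral_radius (C_mat B \<sigma> d)"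
      "positive_right_eigenvector (C_mat B \<sigma> d) v"
    then show "limit_trichotomy x v"
      using limits(1)[OF E_mat_eq_C_mat] by (auto simp: assumption2_def)
  next
    fix d
    assume "assumption2 B \<sigma> d" "d > spectral_radius (C_mat B \<sigma> d)"
    then show "(x \<longlongrightarrow> 0) at_top"
      using limits(2)[OF E_mat_eq_C_mat] by (auto simp: assumption2_def)
  qed
qed

end
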